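(* Assume that $\mathcal{E}$ is convex on $\Delta_{n_{\mathcal Y}}$. Then $$\inf_{k\in K}\ \inf_{\nu\in\mathrm{BR}(k)}G(\nu,k)=\inf_{\nu\in\Delta_{n_{\mathcal Y}}}\ \inf_{k\in\left(-\partial_\nu\mathrm{OT}(\mu,\nu,c)-\nabla\mathcal{E}[\nu]\right)\cap K}G(\nu,k),$$ with the convention $\inf\emptyset=\infty$.
   Context: $\mathcal{X}=\{x_1,\ldots,x_{n_{\mathcal X}}\}$ and $\mathcal{Y}=\{y_1,\ldots,y_{n_{\mathcal Y}}\}$ are finite sets. Probability measures on them are identified with vectors in $\Delta_{n_{\mathcal X}}$, $\Delta_{n_{\mathcal Y}}$, where $\Delta_n=\{\omega\in[0,1]^n:\sum_i\omega_i=1\}$; $\mu\in\Delta_{n_{\mathcal X}}$ is fixed. The data are: $c\in\mathbb{R}^{n_{\mathcal X}\times n_{\mathcal Y}}$; continuous nondecreasing functions $f_j:[0,1]\to\mathbb{R}$, $j=1,\ldots,n_{\mathcal Y}$; a symmetric matrix $\theta\in\mathbb{R}^{n_{\mathcal Y}\times n_{\mathcal Y}}$; a set $K\subseteq\mathbb{R}^{n_{\mathcal Y}}$; and a continuous function $G:\Delta_{n_{\mathcal Y}}\times K\to\mathbb{R}$. The energy is $\mathcal{E}[\nu]=\sum_jF_j(\nu_j)+\tfrac12\sum_{a,j}\theta_{aj}\nu_a\nu_j$, $F_j(t)=\int_0^tf_j(s)\,ds$, with gradient $(\nabla\mathcal{E}[\nu])_j=f_j(\nu_j)+\sum_a\theta_{aj}\nu_a$.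 $\mathrm{OT}(\mu,\nu,c)=\min_\gamma\sum_{i,j}c_{ij}\gamma_{ij}$ over probability measures $\gamma$ on $\mathcal{X}\times\mathcal{Y}$ with marginals $\mu,\nu$. Its subdifferential in $\nu\in\Delta_{n_{\mathcal Y}}$ is $$\partial_\nu\mathrm{OT}(\mu,\nu,c)=\{f\in\mathbb{R}^{n_{\mathcal Y}}:\mathrm{OT}(\mu,\nu,c)-f\cdot\nu\le\mathrm{OT}(\mu,\eta,c)-f\cdot\eta\ \ \forall\eta\in\Delta_{n_{\mathcal Y}}\}.$$ For $k\in K$, $\mathrm{BR}(k)\subseteq\Delta_{n_{\mathcal Y}}$ is the set of all minimizers of $\nu\mapsto\mathrm{OT}(\mu,\nu,c)+k\cdot\nu+\mathcal{E}[\nu]$ over $\nu\in\Delta_{n_{\mathcal Y}}$. *)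

theory Defs
  imports "HOL-Analysis.Analysis"
begin

text \<open>
  The finite sets are the universes of two finite types \<open>'x\<close> and \<open>'y\<close>; a probability measure on
  one of them is the vector of its masses.
\<close>

definition prob_simplex :: "(real ^ 'n) set" where
  "prob_simplex = {w. (\<forall>i. w $ i \<in> {0..1}) \<and> (\<Sum>i\<in>UNIV. w $ i) = 1}"

definition couplings :: "real ^ 'x \<Rightarrow> real ^ 'y \<Rightarrow> (real ^ 'y ^ 'x) set" where
  "couplings \<mu> \<nu> = {\<gamma>. (\<forall>i j. 0 \<le> \<gamma> $ i $ j) \<and> (\<Sum>i\<in>UNIV. \<Sum>j\<in>UNIV. \<gamma> $ i $ j) = 1 \<and>
     (\<forall>i. (\<Sum>j\<in>UNIV. \<gamma> $ i $ j) = \<mu> $ i) \<and> (\<forall>j. (\<Sum>i\<in>UNIV. \<gamma> $ i $ j) = \<nu> $ j)}"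

definition transport_cost :: "real ^ 'y ^ 'x \<Rightarrow> real ^ 'y ^ 'x \<Rightarrow> real" where
  "transport_cost c \<gamma> = (\<Sum>i\<in>UNIV. \<Sum>j\<in>UNIV. c $ i $ j * \<gamma> $ i $ j)"

text \<open>
  The infimum is a minimum whenever both marginals are probability vectors; see \<open>OT_attained\<close>.
\<close>

definition OT :: "real ^ 'x \<Rightarrow> real ^ 'y \<Rightarrow> real ^ 'y ^ 'x \<Rightarrow> real" where
  "OT \<mu> \<nu> c = (INF \<gamma>\<in>couplings \<mu> \<nu>. transport_cost c \<gamma>)"

definition OT_subdiff :: "real ^ 'x \<Rightarrow> real ^ 'y \<Rightarrow> real ^ 'y ^ 'x \<Rightarrow> (real ^ 'y) set" where
  "OT_subdiff \<mu> \<nu> c =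
     {g. \<forall>\<eta>\<in>prob_simplex. OT \<mu> \<nu> c - g \<bullet> \<nu> \<le> OT \<mu> \<eta> c - g \<bullet> \<eta>}"

definition energy :: "('y \<Rightarrow> real \<Rightarrow> real) \<Rightarrow> real ^ 'y ^ 'y \<Rightarrow> real ^ 'y \<Rightarrow> real" where
  "energy f \<theta> \<nu> = (\<Sum>j\<in>UNIV. integral {0..\<nu> $ j} (f j)) +
     1 / 2 * (\<Sum>a\<in>UNIV. \<Sum>j\<in>UNIV. \<theta> $ a $ j * \<nu> $ a * \<nu> $ j)"

text \<open>
  The gradient is given by its explicit formula: each \<open>f j\<close> is only controlled on \<open>{0..1}\<close>, so on
  the boundary of the simplex the energy need not have a derivative in the full space.
\<close>

definition grad_energy :: "('y \<Rightarrow> real \<Rightarrow> real) \<Rightarrow> real ^ 'y ^ 'y \<Rightarrow> real ^ 'y \<Rightarrow> real ^ 'y" where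
  "grad_energy f \<theta> \<nu> = (\<chi> j. f j (\<nu> $ j) + (\<Sum>a\<in>UNIV. \<theta> $ a $ j * \<nu> $ a))"

definition best_response ::
    "real ^ 'x \<Rightarrow> real ^ 'y ^ 'x \<Rightarrow> ('y \<Rightarrow> real \<Rightarrow> real) \<Rightarrow> real ^ 'y ^ 'y \<Rightarrow> real ^ 'y \<Rightarrow> (real ^ 'y) set" where
  "best_response \<mu> c f \<theta> k = {\<nu> \<in> prob_simplex. \<forall>\<eta>\<in>prob_simplex.
     OT \<mu> \<nu> c + k \<bullet> \<nu> + energy f \<theta> \<nu> \<le> OT \<mu> \<eta> c + k \<bullet> \<eta> + energy f \<theta> \<eta>}"

lemma couplings_nonempty:
  assumes "\<mu> \<in> prob_simplex" "\<nu> \<in> prob_simplex"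
  shows "couplings \<mu> \<nu> \<noteq> {}"
proof -
  have "(\<chi> i j. \<mu> $ i * \<nu> $ j) \<in> couplings \<mu> \<nu>"
    using assms
    by (auto simp: couplings_def prob_simplex_def simp flip: sum_distrib_left sum_distrib_right)
  then show ?thesis by blast
qed

lemma compact_couplings:
  fixes \<mu> :: "real ^ 'x" and \<nu> :: "real ^ 'y"
  shows "compact (couplings \<mu> \<nu>)"
proof -
  have "norm \<gamma> \<le> 1" if "\<gamma> \<in> couplings \<mu> \<nu>" for \<gamma> :: "real ^ 'y ^ 'x"
  proof -
    have "norm \<gamma> \<le> (\<Sum>i\<in>UNIV. norm (\<gamma> $ i))"
      unfolding norm_vec_def[of \<gamma>] by (rule L2_set_le_sum) simp
    also have "\<dots> \<le> (\<Sum>i\<in>UNIV. \<Sum>j\<in>UNIV. \<bar>\<gamma> $ i $ j\<bar>)"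
      by (intro sum_mono norm_le_l1_cart)
    also have "\<dots> = (\<Sum>i\<in>UNIV. \<Sum>j\<in>UNIV. \<gamma> $ i $ j)"
      using that by (intro sum.cong refl) (simp add: couplings_def)
    also have "\<dots> = 1"
      using that unfolding couplings_def by blast
    finally show ?thesis .
  qed
  then have "bounded (couplings \<mu> \<nu>)"
    unfolding bounded_iff by blast
  moreover have "closed (couplings \<mu> \<nu>)"
    unfolding couplings_def
    by (intro closed_Collect_conj closed_Collect_all closed_Collect_le closed_Collect_eq
        continuous_intros)
  ultimately show ?thesis
    by (simp add: compact_eq_bounded_closed)
qed

lemma OT_attained:
  assumes "\<mu> \<in> prob_simplex" "\<nu> \<in> prob_simplex"
  obtains \<gamma> where "\<gamma> \<in> couplings \<mu> \<nu>" "OT \<mu> \<nu> c = transport_cost c \<gamma>"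
    "\<And>\<gamma>'. \<gamma>' \<in> couplings \<mu> \<nu> \<Longrightarrow> transport_cost c \<gamma> \<le> transport_cost c \<gamma>'"
proof -
  have "continuous_on (couplings \<mu> \<nu>) (transport_cost c)"
    unfolding transport_cost_def by (intro continuous_intros)
  then obtain \<gamma> where \<gamma>: "\<gamma> \<in> couplings \<mu> \<nu>"
      "\<And>\<gamma>'. \<gamma>' \<in> couplings \<mu> \<nu> \<Longrightarrow> transport_cost c \<gamma> \<le> transport_cost c \<gamma>'"
    using continuous_attains_inf[OF compact_couplings couplings_nonempty[OF assms]] by blast
  have "OT \<mu> \<nu> c = transport_cost c \<gamma>"
    unfolding OT_def by (rule cInf_eq_minimum) (use \<gamma> in auto)
  with \<gamma> that show thesis by blast
qed

end

theory Submission
  imports Defs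
begin

text \<open>
  A point \<open>\<nu>\<close> of the simplex is a best response to \<open>k\<close> iff it satisfies the first-order condition
  \<open>- k - grad_energy f \<theta> \<nu> \<in> OT_subdiff \<mu> \<nu> c\<close>, so both sides are infima of \<open>G\<close> over the same set of
  pairs. Sufficiency is the gradient inequality for the convex energy; necessity compares \<open>\<nu>\<close> with
  the points of a segment issuing from it, using that \<open>OT\<close> is convex and that the energy has
  a one-sided derivative along the segment.
\<close>

lemma convex_prob_simplex: "convex (prob_simplex :: (real ^ 'n) set)"
proof -
  have eq: "prob_simplex = {w :: real ^ 'n. (\<forall>i. 0 \<le> w $ i) \<and> (\<Sum>i\<in>UNIV. w $ i) = 1}"
  proof (intro set_eqI iffI)
    fix w :: "real ^ 'n"
    assume w: "w \<in> {w. (\<forall>i. 0 \<le> w $ i) \<and> (\<Sum>i\<in>UNIV. w $ i) = 1}"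
    then have "w $ i \<le> 1" for i
      using member_le_sum[of i UNIV "($) w"] by simp
    with w show "w \<in> prob_simplex" by (simp add: prob_simplex_def)
  qed (simp add: prob_simplex_def)
  show ?thesis
    unfolding eq by (auto simp: convex_def sum.distrib simp flip: sum_distrib_left)
qed

text \<open>The constraints are affine in the plan and its second marginal jointly, and both plans
  share the first marginal \<mu>, which mixing therefore preserves.\<close>

lemma couplings_convex_combination:
  assumes "\<gamma> \<in> couplings \<mu> \<nu>" "\<gamma>' \<in> couplings \<mu> \<eta>" "0 \<le> t" "t \<le> 1"
  shows "(1 - t) *\<^sub>R \<gamma> + t *\<^sub>R \<gamma>' \<in> couplings \<mu> ((1 - t) *\<^sub>R \<nu> + t *\<^sub>R \<eta>)"
  using assms
  by (simp add: couplings_def sum.distrib flip: sum_distrib_left) (auto simp: algebra_simps)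

lemma transport_cost_convex_combination:
  "transport_cost c ((1 - t) *\<^sub>R \<gamma> + t *\<^sub>R \<gamma>') =
    (1 - t) * transport_cost c \<gamma> + t * transport_cost c \<gamma>'"
  unfolding transport_cost_def sum_distrib_left sum.distrib[symmetric]
  by (intro sum.cong refl) (simp add: algebra_simps)

text \<open>Mixing optimal plans for the two end marginals yields an admissible plan for the mixed
  marginal. Since the cost is linear in the plan, its cost is the mixture of the two optimal
  values.\<close>

lemma convex_on_OT:
  assumes \<mu>: "\<mu> \<in> prob_simplex"
  shows "convex_on prob_simplex (\<lambda>\<nu>. OT \<mu> \<nu> c)"
proof (rule convex_onI)
  fix t :: real and \<nu> \<eta> :: "real ^ 'b"
  assume t: "0 < t" "t < 1" and \<nu>: "\<nu> \<in> prob_simplex" and \<eta>: "\<eta> \<in> prob_simplex"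
  obtain \<gamma> where \<gamma>: "\<gamma> \<in> couplings \<mu> \<nu>" "OT \<mu> \<nu> c = transport_cost c \<gamma>"
    using OT_attained[OF \<mu> \<nu>] by blast
  obtain \<gamma>' where \<gamma>': "\<gamma>' \<in> couplings \<mu> \<eta>" "OT \<mu> \<eta> c = transport_cost c \<gamma>'"
    using OT_attained[OF \<mu> \<eta>] by blast
  let ?\<zeta> = "(1 - t) *\<^sub>R \<nu> + t *\<^sub>R \<eta>"
  have "?\<zeta> \<in> prob_simplex"
    using convexD_alt[OF convex_prob_simplex \<nu> \<eta>] t by simp
  then obtain \<gamma>0 where "OT \<mu> ?\<zeta> c = transport_cost c \<gamma>0"
      and min: "\<And>\<gamma>'. \<gamma>' \<in> couplings \<mu> ?\<zeta> \<Longrightarrow> transport_cost c \<gamma>0 \<le> transport_cost c \<gamma>'"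
    using OT_attained[OF \<mu>] by blast
  moreover have "(1 - t) *\<^sub>R \<gamma> + t *\<^sub>R \<gamma>' \<in> couplings \<mu> ?\<zeta>"
    using couplings_convex_combination \<gamma>(1) \<gamma>'(1) t by (metis less_imp_le)
  ultimately show "OT \<mu> ?\<zeta> c \<le> (1 - t) * OT \<mu> \<nu> c + t * OT \<mu> \<eta> c"
    using \<gamma>(2) \<gamma>'(2) by (metis transport_cost_convex_combination)
qed (rule convex_prob_simplex)

text \<open>The derivative is one-sided because the segment may leave the simplex beyond \<nu>,
  where nothing is known about \<open>f j\<close>. The integral terms are differentiated by the
  fundamental theorem of calculus, the quadratic term by the product rule.\<close>

lemma energy_has_derivative_on_segment:
  fixes f :: "'y::finite \<Rightarrow> real \<Rightarrow> real"
  assumes cont: "\<And>j. continuous_on {0..1} (f j)" and sym: "transpose \<theta> = \<theta>"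
    and \<nu>: "\<nu> \<in> prob_simplex" and \<eta>: "\<eta> \<in> prob_simplex"
  shows "((\<lambda>t. energy f \<theta> ((1 - t) *\<^sub>R \<nu> + t *\<^sub>R \<eta>)) has_real_derivative
    grad_energy f \<theta> \<nu> \<bullet> (\<eta> - \<nu>)) (at 0 within {0..1})"
proof -
  let ?z = "\<lambda>j t. (1 - t) * \<nu> $ j + t * \<eta> $ j"
  have z: "(?z j has_real_derivative (\<eta> - \<nu>) $ j) (at t within S)" for j t S
    by (auto intro!: derivative_eq_intros)
  have F: "((\<lambda>t. integral {0..?z j t} (f j)) has_real_derivative f j (\<nu> $ j) * (\<eta> - \<nu>) $ j)
      (at 0 within {0..1})" for j
  proof -
    have \<nu>\<eta>: "\<nu> $ j \<in> {0..1}" "\<eta> $ j \<in> {0..1}"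
      using \<nu> \<eta> by (simp_all add: prob_simplex_def)
    have "?z j t \<in> {0..1}" if "t \<in> {0..1}" for t
      using convexD_alt[of "{0..1::real}" "\<nu> $ j" "\<eta> $ j" t] \<nu>\<eta> that by simp
    \<comment> \<open>\<open>DERIV_image_chain\<close> wants the outer derivative within the image
      of the path, whereas the fundamental theorem gives it within \<open>{0..1}\<close>; this
      inclusion bridges the two.\<close>
    then have "?z j ` {0..1} \<subseteq> {0..1}" by blast
    moreover have "((\<lambda>x. integral {0..x} (f j)) has_real_derivative f j (?z j 0))
        (at (?z j 0) within {0..1})"
      using integral_has_real_derivative[OF cont] \<nu>\<eta>(1) by simp
    ultimately have "((\<lambda>x. integral {0..x} (f j)) has_real_derivative f j (?z j 0))
        (at (?z j 0) within ?z j ` {0..1})"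
      by (rule DERIV_subset[rotated])
    from DERIV_image_chain[OF this z] show ?thesis by (simp add: o_def)
  qed
  have SF: "((\<lambda>t. \<Sum>j\<in>UNIV. integral {0..?z j t} (f j)) has_real_derivative
      (\<Sum>j\<in>UNIV. f j (\<nu> $ j) * (\<eta> - \<nu>) $ j)) (at 0 within {0..1})"
    by (intro DERIV_sum F)
  have Q: "((\<lambda>t. \<Sum>a\<in>UNIV. \<Sum>j\<in>UNIV. \<theta> $ a $ j * ?z a t * ?z j t) has_real_derivative
      (\<Sum>a\<in>UNIV. \<Sum>j\<in>UNIV. \<theta> $ a $ j * (\<eta> - \<nu>) $ a * \<nu> $ j + \<theta> $ a $ j * \<nu> $ a * (\<eta> - \<nu>) $ j))
      (at 0 within {0..1})"
    by (intro DERIV_sum) (auto intro!: derivative_eq_intros simp: algebra_simps)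
  have \<theta>: "\<theta> $ a $ j = \<theta> $ j $ a" for a j
    by (subst sym[symmetric]) (simp add: transpose_def)
  \<comment> \<open>Exchanging the indices and using symmetry of \<theta>, the two halves of the
    product rule agree, so their sum absorbs the factor \<open>1 / 2\<close>.\<close>
  have "(\<Sum>a\<in>UNIV. \<Sum>j\<in>UNIV. \<theta> $ a $ j * (\<eta> - \<nu>) $ a * \<nu> $ j) =
      (\<Sum>a\<in>UNIV. \<Sum>j\<in>UNIV. \<theta> $ a $ j * \<nu> $ a * (\<eta> - \<nu>) $ j)"
    by (subst sum.swap) (intro sum.cong refl, subst \<theta>, simp)
  then have "(\<Sum>j\<in>UNIV. f j (\<nu> $ j) * (\<eta> - \<nu>) $ j) + 1 / 2 *
      (\<Sum>a\<in>UNIV. \<Sum>j\<in>UNIV. \<theta> $ a $ j * (\<eta> - \<nu>) $ a * \<nu> $ j + \<theta> $ a $ j * \<nu> $ a * (\<eta> - \<nu>) $ j)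
      = (\<Sum>j\<in>UNIV. f j (\<nu> $ j) * (\<eta> - \<nu>) $ j)
        + (\<Sum>a\<in>UNIV. \<Sum>j\<in>UNIV. \<theta> $ a $ j * \<nu> $ a * (\<eta> - \<nu>) $ j)"
    unfolding sum.distrib by simp
  also have "\<dots> = grad_energy f \<theta> \<nu> \<bullet> (\<eta> - \<nu>)"
    unfolding grad_energy_def inner_vec_def
    by (subst sum.swap) (simp only: vec_lambda_beta inner_real_def distrib_right
        sum_distrib_right sum.distrib)
  finally show ?thesis
    using DERIV_add[OF SF DERIV_cmult[OF Q, of "1 / 2"]]
    by (simp add: energy_def)
qed

text \<open>Divide by \<open>t\<close> and let \<open>t\<close> decrease to 0: a bound on all
  difference quotients survives in the limit. Upper bounds come from applying this to the negated
  function.\<close>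

lemma has_real_derivative_ge:
  fixes \<phi> :: "real \<Rightarrow> real"
  assumes der: "(\<phi> has_real_derivative D) (at 0 within {0..1})"
    and le: "\<And>t. 0 < t \<Longrightarrow> t \<le> 1 \<Longrightarrow> t * C \<le> \<phi> t - \<phi> 0"
  shows "C \<le> D"
proof (rule tendsto_lowerbound)
  show "((\<lambda>t. (\<phi> t - \<phi> 0) / (t - 0)) \<longlongrightarrow> D) (at 0 within {0..1})"
    using der by (simp add: has_field_derivative_iff)
  show "\<forall>\<^sub>F t in at 0 within {0..1}. C \<le> (\<phi> t - \<phi> 0) / (t - 0)"
    using le by (auto simp: eventually_at_filter field_simps)
  show "at 0 within {0..1::real} \<noteq> bot"
    by (simp add: trivial_limit_within islimpt_Icc)
qed

lemma energy_gradient_inequality: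
  fixes f :: "'y::finite \<Rightarrow> real \<Rightarrow> real"
  assumes cont: "\<And>j. continuous_on {0..1} (f j)" and sym: "transpose \<theta> = \<theta>"
    and conv: "convex_on prob_simplex (energy f \<theta>)"
    and \<nu>: "\<nu> \<in> prob_simplex" and \<eta>: "\<eta> \<in> prob_simplex"
  shows "energy f \<theta> \<nu> + grad_energy f \<theta> \<nu> \<bullet> (\<eta> - \<nu>) \<le> energy f \<theta> \<eta>"
proof -
  \<comment> \<open>Convexity bounds the difference quotients of the energy from above by the secant
    slope, so the sign is flipped to fit \<open>has_real_derivative_ge\<close>.\<close>
  have "t * (energy f \<theta> \<nu> - energy f \<theta> \<eta>)
      \<le> - energy f \<theta> ((1 - t) *\<^sub>R \<nu> + t *\<^sub>R \<eta>) - - energy f \<theta> ((1 - 0) *\<^sub>R \<nu> + 0 *\<^sub>R \<eta>)"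
    if "0 < t" "t \<le> 1" for t
    using convex_onD[OF conv _ _ \<nu> \<eta>, of t] that by (simp add: algebra_simps)
  from has_real_derivative_ge[OF DERIV_minus[OF energy_has_derivative_on_segment] this]
  show ?thesis using cont sym \<nu> \<eta> by fastforce
qed

lemma best_response_iff:
  fixes f :: "'y::finite \<Rightarrow> real \<Rightarrow> real"
  assumes \<mu>: "\<mu> \<in> prob_simplex"
    and cont: "\<And>j. continuous_on {0..1} (f j)" and sym: "transpose \<theta> = \<theta>"
    and conv: "convex_on prob_simplex (energy f \<theta>)"
  shows "\<nu> \<in> best_response \<mu> c f \<theta> k \<longleftrightarrow>
    \<nu> \<in> prob_simplex \<and> - k - grad_energy f \<theta> \<nu> \<in> OT_subdiff \<mu> \<nu> c" (is "?L \<longleftrightarrow> ?R")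
proof
  assume ?L
  then have \<nu>: "\<nu> \<in> prob_simplex"
    and min: "\<And>\<eta>. \<eta> \<in> prob_simplex \<Longrightarrow>
      OT \<mu> \<nu> c + k \<bullet> \<nu> + energy f \<theta> \<nu> \<le> OT \<mu> \<eta> c + k \<bullet> \<eta> + energy f \<theta> \<eta>"
    by (auto simp: best_response_def)
  \<comment> \<open>This is the subgradient inequality for
    \<open>- k - grad_energy f \<theta> \<nu>\<close>, rearranged so that the right side is the
    directional derivative of the energy and the left side is a constant bounding its
    quotients.\<close>
  have "OT \<mu> \<nu> c - OT \<mu> \<eta> c - k \<bullet> (\<eta> - \<nu>) \<le> grad_energy f \<theta> \<nu> \<bullet> (\<eta> - \<nu>)"
    if \<eta>: "\<eta> \<in> prob_simplex" for \<eta>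
  proof (rule has_real_derivative_ge)
    show "((\<lambda>t. energy f \<theta> ((1 - t) *\<^sub>R \<nu> + t *\<^sub>R \<eta>)) has_real_derivative
        grad_energy f \<theta> \<nu> \<bullet> (\<eta> - \<nu>)) (at 0 within {0..1})"
      using energy_has_derivative_on_segment[OF cont sym \<nu> \<eta>] .
    fix t :: real
    assume t: "0 < t" "t \<le> 1"
    let ?\<zeta> = "(1 - t) *\<^sub>R \<nu> + t *\<^sub>R \<eta>"
    have "?\<zeta> \<in> prob_simplex"
      using convexD_alt[OF convex_prob_simplex \<nu> \<eta>] t by simp
    \<comment> \<open>Minimality at \<nu> bounds the energy increment below by the decrease of
      \<open>OT\<close> and of the linear term. Convexity makes the decrease of \<open>OT\<close> at
      least \<open>t\<close> times its decrease over the whole segment.\<close>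
    then show "t * (OT \<mu> \<nu> c - OT \<mu> \<eta> c - k \<bullet> (\<eta> - \<nu>))
        \<le> energy f \<theta> ?\<zeta> - energy f \<theta> ((1 - 0) *\<^sub>R \<nu> + 0 *\<^sub>R \<eta>)"
      using min[of ?\<zeta>] convex_onD[OF convex_on_OT[OF \<mu>, of c] _ _ \<nu> \<eta>, of t] t
      by (simp add: algebra_simps)
  qed
  with \<nu> show ?R
    by (force simp: OT_subdiff_def inner_diff_left inner_diff_right)
next
  assume ?R
  \<comment> \<open>Adding the subgradient inequality to the gradient inequality of the energy
    cancels the gradient terms and leaves minimality.\<close>
  then show ?L
    using energy_gradient_inequality[OF cont sym conv]
    by (force simp: best_response_def OT_subdiff_def inner_diff_left inner_diff_right)
qed

theorem theorem5p7:
  fixes \<mu> :: "real ^ 'x"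
    and c :: "real ^ 'y ^ 'x"
    and f :: "'y \<Rightarrow> real \<Rightarrow> real"
    and \<theta> :: "real ^ 'y ^ 'y"
    and K :: "(real ^ 'y) set"
    and G :: "real ^ 'y \<Rightarrow> real ^ 'y \<Rightarrow> real"
  assumes "\<mu> \<in> prob_simplex"
    and "\<And>j. continuous_on {0..1} (f j)"
    and "\<And>j. mono_on {0..1} (f j)"
    and "transpose \<theta> = \<theta>"
    and "continuous_on (prob_simplex \<times> K) (\<lambda>(\<nu>, k). G \<nu> k)"
    and "convex_on prob_simplex (energy f \<theta>)"
  shows "(INF k\<in>K. INF \<nu>\<in>best_response \<mu> c f \<theta> k. ereal (G \<nu> k)) =
    (INF \<nu>\<in>prob_simplex.
       INF k\<in>(\<lambda>g. - g - grad_energy f \<theta> \<nu>) ` OT_subdiff \<mu> \<nu> c \<inter> K. ereal (G \<nu> k))"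
proof -
  \<comment> \<open>The map \<open>\<lambda>g. - g - grad_energy f \<theta> \<nu>\<close> is its own
    inverse, so membership in the image is membership of the mapped point.\<close>
  have "k \<in> (\<lambda>g. - g - grad_energy f \<theta> \<nu>) ` OT_subdiff \<mu> \<nu> c \<longleftrightarrow>
      - k - grad_energy f \<theta> \<nu> \<in> OT_subdiff \<mu> \<nu> c" for \<nu> k
    by (force simp: image_iff)
  then have "\<nu> \<in> best_response \<mu> c f \<theta> k \<longleftrightarrow>
      \<nu> \<in> prob_simplex \<and> k \<in> (\<lambda>g. - g - grad_energy f \<theta> \<nu>) ` OT_subdiff \<mu> \<nu> c" for \<nu> k
    by (simp only: best_response_iff[OF assms(1,2,4,6)])
  \<comment> \<open>Both iterated infima run over the same pairs in opposite order, so each value on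
    one side bounds the other side from above. An empty inner range gives \<infinity> in
    \<open>ereal\<close>, so no case distinction arises.\<close>
  then show ?thesis
    by (intro antisym INF_greatest) (blast intro: INF_lower2)+
qed

end
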